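(* Let $D\ge2$ be squarefree and $K=\mathbb{Q}(\sqrt D)$ with discriminant $\Delta$. If $\alpha\in\mathcal{O}_K^+$ satisfies $p_K(\alpha\,|\,\mathcal{I})=2$, then \[ \mathrm{N}(\alpha) < 5\sqrt{\Delta}\left(\sqrt{\Delta}+1\right)\left(3\sqrt{\Delta}+2\right). \]
   Context: $\mathcal{O}_K^+$ is the set of totally positive elements of $\mathcal{O}_K$; $\mathrm{N}(\alpha)=\alpha\alpha'$ with $\alpha'$ the Galois conjugate. $\Delta=D$ if $D\equiv1\pmod4$, $\Delta=4D$ otherwise. An element of $\mathcal{O}_K^+$ is indecomposable if it is not a sum of two elements of $\mathcal{O}_K^+$. $p_K(\alpha\,|\,\mathcal{I})$ is the number of unordered representations of $\alpha$ as a sum $\lambda_1+\dots+\lambda_\ell$ ($\ell\ge1$) of indecomposables. *)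

theory Defs
  imports Complex_Main "HOL-Computational_Algebra.Computational_Algebra"
begin

text \<open>
  The real quadratic field \<open>\<rat>(\<surd>D)\<close> is represented as a subfield of \<open>\<real>\<close>, i.e. through the
  embedding sending \<open>\<surd>D\<close> to the positive square root of \<open>D\<close>.
\<close>

definition quad_field :: "nat \<Rightarrow> real set" where
  "quad_field D = {a + b * sqrt (real D) | a b. a \<in> \<rat> \<and> b \<in> \<rat>}"

definition ring_of_integers :: "nat \<Rightarrow> real set" where
  "ring_of_integers D = {x \<in> quad_field D. algebraic_int x}"

text \<open>
  The Galois conjugate is meaningful only for \<open>x\<close> in the field and \<open>D\<close> not a perfect square;
  see \<open>gal_conj_eq\<close> below.
\<close>

definition gal_conj :: "nat \<Rightarrow> real \<Rightarrow> real" where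
  "gal_conj D x =
     (THE y. \<exists>a\<in>\<rat>. \<exists>b\<in>\<rat>. x = a + b * sqrt (real D) \<and> y = a - b * sqrt (real D))"

definition quad_norm :: "nat \<Rightarrow> real \<Rightarrow> real" where
  "quad_norm D x = x * gal_conj D x"

definition tot_pos_integers :: "nat \<Rightarrow> real set" where
  "tot_pos_integers D = {x \<in> ring_of_integers D. x > 0 \<and> gal_conj D x > 0}"

definition quad_disc :: "nat \<Rightarrow> nat" where
  "quad_disc D = (if D mod 4 = 1 then D else 4 * D)"

definition indecomposables :: "nat \<Rightarrow> real set" where
  "indecomposables D =
     {x \<in> tot_pos_integers D.
        \<not> (\<exists>y\<in>tot_pos_integers D. \<exists>z\<in>tot_pos_integers D. x = y + z)}"

text \<open>
  Unordered representations with at least one part are nonempty multisets of indecomposables.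
  An infinite number of representations would be counted as \<open>0\<close>.
\<close>

definition indecomposable_partitions :: "nat \<Rightarrow> real \<Rightarrow> nat" where
  "indecomposable_partitions D x =
     card {M. M \<noteq> {#} \<and> set_mset M \<subseteq> indecomposables D \<and> sum_mset M = x}"

lemma sqrt_squarefree_irrational:
  assumes "squarefree D" "D \<ge> 2"
  shows "sqrt (real D) \<notin> \<rat>"
proof
  assume "sqrt (real D) \<in> \<rat>"
  moreover have "algebraic_int (sqrt (real D))"
    by (intro algebraic_int_sqrt algebraic_int_of_nat)
  ultimately have "sqrt (real D) \<in> \<int>"
    using rational_algebraic_int_is_int by blast
  then obtain k where "sqrt (real D) = of_int k"
    by (auto elim: Ints_cases)
  then have "real D = (of_int k)^2"
    by (metis of_nat_0_le_iff real_sqrt_pow2)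
  then have "real D = real (nat \<bar>k\<bar> ^ 2)"
    by simp
  then have D: "D = nat \<bar>k\<bar> ^ 2"
    using of_nat_eq_iff by blast
  then have "nat \<bar>k\<bar> dvd 1"
    using assms(1) unfolding squarefree_def by (metis dvd_refl)
  then show False using D assms(2) by simp
qed

lemma gal_conj_eq:
  assumes "squarefree D" "D \<ge> 2" "a \<in> \<rat>" "b \<in> \<rat>"
  shows "gal_conj D (a + b * sqrt (real D)) = a - b * sqrt (real D)"
  unfolding gal_conj_def
proof (rule the_equality)
  show "\<exists>c\<in>\<rat>. \<exists>d\<in>\<rat>. a + b * sqrt (real D) = c + d * sqrt (real D) \<and>
          a - b * sqrt (real D) = c - d * sqrt (real D)"
    using assms by blast
next
  fix y
  assume "\<exists>c\<in>\<rat>. \<exists>d\<in>\<rat>. a + b * sqrt (real D) = c + d * sqrt (real D) \<and>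
            y = c - d * sqrt (real D)"
  then obtain c d where cd: "c \<in> \<rat>" "d \<in> \<rat>"
      "a + b * sqrt (real D) = c + d * sqrt (real D)" "y = c - d * sqrt (real D)"
    by blast
  have "b = d"
  proof (rule ccontr)
    assume "b \<noteq> d"
    then have "sqrt (real D) = (c - a) / (b - d)"
      using cd(3) by (simp add: field_simps)
    also have "\<dots> \<in> \<rat>"
      using assms cd by simp
    finally show False
      using sqrt_squarefree_irrational assms by blast
  qed
  then show "y = a - b * sqrt (real D)"
    using cd by simp
qed

end

theory Submission
  imports Defs
begin

text \<open>
  Embed the integers as the lattice of points \<open>(x, x')\<close>. Every indecomposable \<open>\<beta>\<close> has two
  indecomposable neighbours \<open>\<delta>, \<gamma>\<close>, each forming a lattice basis with \<open>\<beta>\<close>, and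
  \<open>\<delta> + \<gamma> = v \<beta>\<close> with \<open>v \<ge> 2\<close> and \<open>(v - 2) N(\<beta>) < \<surd>\<Delta>\<close>; moreover \<open>4 N(\<beta>) \<le> \<Delta>\<close>.
  Each \<open>\<alpha>\<close> lies in the cone spanned by two neighbours \<open>\<beta>, \<gamma>\<close>, say \<open>\<alpha> = e \<beta> + f \<gamma>\<close>. The exchange
  \<open>v \<beta> = \<delta> + \<gamma>\<close> and its analogue \<open>w \<gamma> = \<beta> + \<epsilon>\<close> yield a third partition as soon as
  \<open>e \<ge> 2 v\<close>, or \<open>f \<ge> 2 w\<close>, or both \<open>e \<ge> v\<close> and \<open>f \<ge> w\<close>. So exactly two partitions force \<open>e\<close> and
  \<open>f\<close> to be small, and \<open>N(\<alpha>) = e\<^sup>2 N(\<beta>) + f\<^sup>2 N(\<gamma>) + e f (2 \<beta> \<gamma>' + \<surd>\<Delta>)\<close> is bounded termwise.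
\<close>

section \<open>Integral polynomials and quadratic algebraic integers\<close>

lemma map_poly_of_int_add:
  "map_poly (of_int :: int \<Rightarrow> real) (p + q) = map_poly of_int p + map_poly of_int q"
  by (simp add: poly_eq_iff coeff_map_poly)

lemma map_poly_of_int_smult:
  "map_poly (of_int :: int \<Rightarrow> real) (smult c p) = smult (of_int c) (map_poly of_int p)"
  by (simp add: poly_eq_iff coeff_map_poly)

lemma map_poly_of_int_mult:
  "map_poly (of_int :: int \<Rightarrow> real) (p * q) = map_poly of_int p * map_poly of_int q"
  by (simp add: poly_eq_iff coeff_map_poly coeff_mult)

text \<open>Once the gcd \<open>g\<close> is split off, the cofactor \<open>a\<close> of
  \<open>n\<close> is coprime to that of \<open>k\<close>; hence \<open>a\<close> divides
  \<open>g\<close>, and \<open>a^2\<close> divides \<open>n\<close>.\<close>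

lemma squarefree_dvd_square:
  fixes n k :: nat
  assumes "squarefree n" "n dvd k^2"
  shows "n dvd k"
proof -
  have "n \<noteq> 0" using assms(1) not_squarefree_0 by metis
  then obtain a b where ab: "n = a * gcd n k" "k = b * gcd n k" "coprime a b"
    using gcd_coprime_exists[of n k] by auto
  define g where "g = gcd n k"
  have g: "n = a * g" "k = b * g" "g \<noteq> 0" using ab \<open>n \<noteq> 0\<close> by (auto simp: g_def)
  have "g * a dvd g * (b^2 * g)" using assms(2) g by (simp add: power2_eq_square mult_ac)
  then have "a dvd b^2 * g" using g(3) by simp
  then have "a dvd g" using ab(3) by (simp add: coprime_dvd_mult_right_iff)
  then have "a^2 dvd n" using g(1) by (simp add: power2_eq_square)
  then have "a = 1" using assms(1) squarefreeD by fastforce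
  then show ?thesis using g by simp
qed

text \<open>Gauss's lemma: the primitive integral multiple of the minimal polynomial divides a monic
  integral polynomial, so its leading coefficient is a unit.\<close>

lemma algebraic_int_quadratic_coeffs:
  fixes x t n :: real
  assumes "algebraic_int x" "x \<notin> \<rat>" "t \<in> \<rat>" "n \<in> \<rat>" and root: "x^2 - t * x + n = 0"
  shows "t \<in> \<int>" "n \<in> \<int>"
proof -
  obtain p where p: "poly (map_poly of_int p) x = 0" "lead_coeff p = 1"
    using assms(1) unfolding algebraic_int_altdef_ipoly by blast
  obtain t1 t2 where t: "t2 > 0" "t = of_int t1 / of_int t2"
    using assms(3) by (metis Rats_cases')
  obtain n1 n2 where n: "n2 > 0" "n = of_int n1 / of_int n2"
    using assms(4) by (metis Rats_cases')
  \<comment> \<open>\<open>Q0\<close> is \<open>X^2 - t X + n\<close> with denominators cleared by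
    \<open>t2 * n2\<close>.\<close>
  define Q0 where "Q0 = [: n1 * t2, - (t1 * n2), t2 * n2 :]"
  define Q where "Q = primitive_part Q0"
  define c where "c = content Q0"
  have Q0: "Q0 = smult c Q" and c0: "c \<noteq> 0"
    using t n by (auto simp: Q_def c_def Q0_def)
  have cQ: "content Q = 1"
    using t n by (auto simp: Q_def Q0_def content_primitive_part)
  have "degree Q0 = 2"
    using t n by (simp add: Q0_def)
  then have dQ: "degree Q = 2"
    by (simp add: Q0 c0)
  have tn: "of_int t1 = t * of_int t2" "of_int n1 = n * of_int n2"
    using t n by simp_all
  have "poly (map_poly of_int Q0) x = of_int (t2 * n2) * (x^2 - t * x + n)"
    using tn by (simp add: Q0_def map_poly_pCons algebra_simps power2_eq_square)
  then have Qx: "poly (map_poly of_int Q) x = 0"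
    using root c0 by (simp add: Q0 map_poly_of_int_smult)
  \<comment> \<open>Pseudo-division stays over the integers; the remainder has degree at most 1 and
    vanishes at the irrational \<open>x\<close>, so it is zero.\<close>
  define r where "r = pseudo_mod p Q"
  have "Q \<noteq> 0" using dQ by auto
  from pseudo_mod[OF this, of p]
  obtain a A where aA: "a \<noteq> 0" "smult a p = Q * A + r" and "r = 0 \<or> degree r < 2"
    unfolding r_def dQ by blast
  then have "degree r \<le> 1" by auto
  then have "r = [:coeff r 0, coeff r 1:]"
    by (intro poly_eqI) (auto simp: coeff_pCons coeff_eq_0 split: nat.split)
  then obtain u v where r: "r = [:u, v:]"
    by blast
  have "poly (map_poly of_int (smult a p)) x = poly (map_poly of_int (Q * A + r)) x"
    by (simp add: aA)
  then have ux: "of_int u + of_int v * x = 0"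
    by (simp add: map_poly_of_int_add map_poly_of_int_mult map_poly_of_int_smult Qx p r
        map_poly_pCons mult.commute)
  have "v = 0"
  proof (rule ccontr)
    assume "v \<noteq> 0"
    then have "x = - of_int u / of_int v" using ux by (simp add: field_simps)
    then show False using assms(2) by simp
  qed
  with ux r have "smult a p = Q * A" using aA by simp
  \<comment> \<open>A monic \<open>p\<close> is primitive, so comparing contents gives
    \<open>content A = |a|\<close>; cancelling \<open>|a|\<close> leaves \<open>lead_coeff Q\<close>
    as a divisor of 1.\<close>
  moreover have "content p = 1"
    using content_dvd_coeff[of p "degree p"] p(2) normalize_content[of p] by simp
  ultimately have "content A = \<bar>a\<bar>"
    using cQ by (metis content_mult content_smult mult.right_neutral mult_1 normalize_int_def)
  then have "smult a p = smult \<bar>a\<bar> (Q * primitive_part A)"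
    using \<open>smult a p = Q * A\<close> by (metis content_times_primitive_part mult_smult_right)
  then have "lead_coeff (smult a p) = lead_coeff (smult \<bar>a\<bar> (Q * primitive_part A))" by simp
  then have "a = \<bar>a\<bar> * (lead_coeff Q * lead_coeff (primitive_part A))"
    using p(2) by (simp only: lead_coeff_smult lead_coeff_mult mult_1_right)
  then have "\<bar>a\<bar> = \<bar>a\<bar> * \<bar>lead_coeff Q * lead_coeff (primitive_part A)\<bar>"
    by (metis abs_abs abs_mult)
  then have "\<bar>lead_coeff Q * lead_coeff (primitive_part A)\<bar> = 1"
    using aA(1) by (metis abs_eq_0 mult_cancel_left mult.right_neutral)
  then have "lead_coeff Q dvd 1"
    by (metis dvd_abs_iff dvd_triv_left)
  then have lQ: "\<bar>coeff Q 2\<bar> = 1" using dQ by simp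
  have c2: "t2 * n2 = c * coeff Q 2" "n1 * t2 = c * coeff Q 0" "- (t1 * n2) = c * coeff Q 1"
    using arg_cong[OF Q0, of "\<lambda>q. coeff q 2"] arg_cong[OF Q0, of "\<lambda>q. coeff q 0"]
      arg_cong[OF Q0, of "\<lambda>q. coeff q 1"]
    by (simp_all add: Q0_def numeral_2_eq_2)
  have "real_of_int (t2 * n2) * n = real_of_int (n1 * t2)"
       "real_of_int (t2 * n2) * t = real_of_int (t1 * n2)"
    using tn by simp_all
  then have "real_of_int c * (of_int (coeff Q 2) * n) = of_int c * of_int (coeff Q 0)"
      "real_of_int c * (of_int (coeff Q 2) * t) = of_int c * - of_int (coeff Q 1)"
    using c2 by (simp_all flip: of_int_mult of_int_minus add: mult.assoc[symmetric])
  then have "of_int (coeff Q 2) * n = of_int (coeff Q 0)" "of_int (coeff Q 2) * t = - of_int (coeff Q 1)"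
    by (simp_all only: mult_cancel_left of_int_eq_0_iff c0 simp_thms)
  moreover have "coeff Q 2 = 1 \<or> coeff Q 2 = -1" using lQ by linarith
  ultimately have "n = of_int (coeff Q 0) \<or> n = of_int (- coeff Q 0)"
    "t = of_int (coeff Q 1) \<or> t = of_int (- coeff Q 1)" by auto
  then show "t \<in> \<int>" "n \<in> \<int>" by (metis Ints_of_int)+
qed

subsection \<open>An integral basis\<close>

locale real_quadratic =
  fixes D :: nat
  assumes D_ge_2: "D \<ge> 2" and squarefree_D: "squarefree D"
begin

abbreviation "cj \<equiv> gal_conj D"
abbreviation "OK \<equiv> ring_of_integers D"
abbreviation "OKpos \<equiv> tot_pos_integers D"
abbreviation "Indec \<equiv> indecomposables D"

text \<open>The covolume of the lattice of points \<open>(x, cj x)\<close>; by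
  \<open>det_int\<close> every lattice determinant is an integral multiple of it.\<close>

definition s :: real where "s = sqrt (real (quad_disc D))"

text \<open>Together with 1 this is the usual integral basis; \<open>coords_in_OK\<close> and
  \<open>OK_coords\<close> give the two inclusions.\<close>

definition omega :: real where
  "omega = (if D mod 4 = 1 then (1 + sqrt D) / 2 else sqrt D)"

text \<open>A closed form for the conjugate of \<open>omega\<close>, so that coordinates are
  conjugated through \<open>cj_coords\<close> without the definite description in
  \<open>gal_conj\<close>.\<close>

definition omega' :: real where
  "omega' = (if D mod 4 = 1 then (1 - sqrt D) / 2 else - sqrt D)"

lemma sqrt_D_irrational: "sqrt (real D) \<notin> \<rat>"
  using sqrt_squarefree_irrational D_ge_2 squarefree_D by blast

lemma omega_diff: "omega - omega' = s"
  by (auto simp: omega_def omega'_def s_def quad_disc_def real_sqrt_mult field_simps)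

lemma s_pos: "s > 0"
  using D_ge_2 by (simp add: s_def quad_disc_def)

lemma omega_trace_norm:
  obtains tr nm :: int where "omega + omega' = of_int tr" "omega * omega' = of_int nm"
proof (cases "D mod 4 = 1")
  case True
  have "(4::int) dvd int D - 1"
    using True by presburger
  then obtain k where k: "int D - 1 = 4 * k" by (auto elim: dvdE)
  then have "real D = 1 + 4 * of_int k" by linarith
  moreover have "omega * omega' = (1 - real D) / 4"
    using True by (simp add: omega_def omega'_def field_simps)
  ultimately have "omega * omega' = of_int (- k)" by simp
  moreover have "omega + omega' = of_int 1"
    using True by (simp add: omega_def omega'_def field_simps)
  ultimately show ?thesis using that by blast
next
  case False
  then have "omega + omega' = of_int 0" "omega * omega' = of_int (- int D)"
    by (simp_all add: omega_def omega'_def)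
  then show ?thesis using that by blast
qed

lemma cj_coords: "cj (of_int p + of_int q * omega) = of_int p + of_int q * omega'"
proof (cases "D mod 4 = 1")
  case True
  have x: "of_int p + of_int q * omega = (of_int p + of_int q / 2) + (of_int q / 2) * sqrt D"
    using True by (simp add: omega_def field_simps)
  have "cj (of_int p + of_int q * omega) = (of_int p + of_int q / 2) - (of_int q / 2) * sqrt D"
    unfolding x by (intro gal_conj_eq[OF squarefree_D D_ge_2]) simp_all
  also have "\<dots> = of_int p + of_int q * omega'"
    using True by (simp add: omega'_def field_simps)
  finally show ?thesis .
next
  case False
  then show ?thesis
    using gal_conj_eq[OF squarefree_D D_ge_2, of "of_int p" "of_int q"]
    by (simp add: omega_def omega'_def)
qed

lemma coords_in_OK: "of_int p + of_int q * omega \<in> OK"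
proof -
  let ?x = "of_int p + of_int q * omega"
  obtain tr nm where tn: "omega + omega' = of_int tr" "omega * omega' = of_int nm"
    by (rule omega_trace_norm)
  have root: "omega * omega = of_int tr * omega - of_int nm"
    using tn(1)[symmetric] tn(2)[symmetric] by (simp add: algebra_simps)
  \<comment> \<open>Norm and trace of \<open>p + q * omega\<close>, which make it a root of
    \<open>X^2 - t X + n\<close>.\<close>
  define n t where "n = p^2 + p * q * tr + q^2 * nm" and "t = 2 * p + q * tr"
  have "?x^2 - of_int t * ?x + of_int n = of_int (q^2) * (omega * omega - of_int tr * omega + of_int nm)"
    by (simp add: n_def t_def power2_eq_square algebra_simps)
  moreover have "omega * omega - of_int tr * omega + of_int nm = 0"
    using root by simp
  moreover have "poly [:of_int n, - of_int t, 1:] ?x = ?x^2 - of_int t * ?x + of_int n"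
    by (simp add: algebra_simps power2_eq_square)
  ultimately have "poly [:of_int n, - of_int t, 1:] ?x = 0"
    by simp
  moreover have "\<forall>i. coeff [:of_int n, - of_int t, 1 :: real:] i \<in> \<int>"
    by (auto simp: coeff_pCons split: nat.split)
  ultimately have "algebraic_int ?x"
    using algebraic_int.intros[of "[:of_int n, - of_int t, 1:]" ?x] by simp
  moreover have "?x \<in> quad_field D"
  proof (cases "D mod 4 = 1")
    case True
    then have "?x = (of_int p + of_int q / 2) + (of_int q / 2) * sqrt D"
      by (simp add: omega_def field_simps)
    then show ?thesis unfolding quad_field_def
      by (intro CollectI exI[of _ "of_int p + of_int q / 2"] exI[of _ "of_int q / 2"]) simp
  next
    case False
    then show ?thesis unfolding quad_field_def omega_def
      by (intro CollectI exI[of _ "of_int p"] exI[of _ "of_int q"]) simp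
  qed
  ultimately show ?thesis by (simp add: ring_of_integers_def)
qed

text \<open>The trace \<open>2 * a\<close> and the norm \<open>a^2 - b^2 * D\<close> are integers;
  squarefreeness then makes \<open>2 * b\<close> an integer, and congruences modulo 4 settle the
  parities.\<close>

lemma OK_coords:
  assumes "x \<in> OK"
  obtains p q :: int where "x = of_int p + of_int q * omega"
proof -
  from assms obtain a b where ab: "a \<in> \<rat>" "b \<in> \<rat>" "x = a + b * sqrt D" and x: "algebraic_int x"
    by (auto simp: ring_of_integers_def quad_field_def)
  show ?thesis
  proof (cases "b = 0")
    case True
    then have "x \<in> \<int>"
      using ab x rational_algebraic_int_is_int by auto
    then show ?thesis using that[of _ 0] by (auto elim: Ints_cases)
  next
    case False
    have "x \<notin> \<rat>"
    proof
      assume "x \<in> \<rat>"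
      then have "(x - a) / b \<in> \<rat>" using ab(1,2) by simp
      moreover have "(x - a) / b = sqrt D" using ab False by simp
      ultimately show False using sqrt_D_irrational by simp
    qed
    moreover have "x^2 - (2 * a) * x + (a^2 - b^2 * D) = 0"
      by (simp add: ab power2_eq_square algebra_simps)
    ultimately have "2 * a \<in> \<int>" "a^2 - b^2 * D \<in> \<int>"
      using algebraic_int_quadratic_coeffs[OF x, of "2 * a" "a^2 - b^2 * D"] ab by simp_all
    then obtain m n where m: "2 * a = of_int m" and n: "a^2 - b^2 * D = of_int n"
      by (metis Ints_cases)
    have bD: "(2 * b)^2 * D = of_int (m^2 - 4 * n)"
      using m[symmetric] n[symmetric] by (simp add: power2_eq_square algebra_simps)
    \<comment> \<open>The extra factor \<open>D\<close> makes the rational number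
      \<open>2 * b * D\<close> an integer \<open>k\<close> with \<open>D\<close> dividing
      \<open>k^2\<close>; squarefreeness lets \<open>D\<close> be divided out again.\<close>
    have "(2 * b * D)^2 = ((2 * b)^2 * D) * D"
      by (simp add: power2_eq_square)
    then have sq: "(2 * b * D)^2 = of_int ((m^2 - 4 * n) * D)"
      unfolding bD by simp
    then have "algebraic_int ((2 * b * D)^2)"
      by (metis algebraic_int_of_int)
    then have "algebraic_int (2 * b * D)"
      using algebraic_int_root[of "(2 * b * D)^2" "monom 1 2"] by (simp add: poly_monom degree_monom_eq)
    moreover have "2 * b * D \<in> \<rat>" using ab by simp
    ultimately obtain k where k: "2 * b * D = of_int k"
      using rational_algebraic_int_is_int by (metis Ints_cases)
    have "of_int (k^2) = (of_int ((m^2 - 4 * n) * D) :: real)"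
      using sq unfolding k by simp
    then have "int D dvd k^2"
      by (metis of_int_eq_iff dvd_triv_right)
    then have "D dvd (nat \<bar>k\<bar>)^2"
      by (metis int_dvd_int_iff of_nat_power power2_abs int_nat_eq abs_ge_zero)
    then have "D dvd nat \<bar>k\<bar>"
      using squarefree_D squarefree_dvd_square by blast
    then have "int D dvd k" by (simp add: dvd_nat_abs_iff)
    then obtain l where "k = int D * l" by (auto elim: dvdE)
    then have l: "2 * b = of_int l" using k D_ge_2 by simp
    have "real_of_int (m^2 - 4 * n) = of_int (l^2 * int D)"
      using bD l by simp
    then have "m^2 - 4 * n = l^2 * int D"
      by linarith
    \<comment> \<open>Squares are 0 or 1 modulo 4. As \<open>D\<close> is not 0 modulo 4, an odd
      \<open>l\<close> forces \<open>D\<close> to be 1 modulo 4 and \<open>m\<close> odd.\<close>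
    then have dvd: "4 dvd m^2 - l^2 * int D" by presburger
    have D4: "D mod 4 \<noteq> 0"
    proof
      assume "D mod 4 = 0"
      then have "2^2 dvd D" by auto
      then show False using squarefreeD[OF squarefree_D, of 2] by simp
    qed
    have even_sq: "\<exists>z. y^2 = 4 * z" if "even y" for y :: int
      using that by (auto elim!: evenE simp: power2_eq_square)
    have odd_sq: "\<exists>z. y^2 = 4 * z + 1" if "odd y" for y :: int
    proof -
      from that obtain w where "y = 2 * w + 1" by (auto elim: oddE)
      then have "y^2 = 4 * (w^2 + w) + 1" by (simp add: power2_eq_square algebra_simps)
      then show ?thesis by blast
    qed
    have l_odd: "4 dvd m^2 - int D" if "odd l"
    proof -
      from odd_sq[OF that] obtain z where "l^2 = 4 * z + 1" by blast
      then have "m^2 - int D = (m^2 - l^2 * int D) + 4 * (z * int D)" by (simp add: algebra_simps)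
      then show ?thesis using dvd by (metis dvd_add dvd_triv_left)
    qed
    have l_even: "even m" if "even l"
    proof -
      have "even (m^2 - l^2 * int D)" using dvd by presburger
      then show ?thesis using that by simp
    qed
    have m_sq: "(\<exists>z. m^2 = 4 * z) \<and> even m \<or> (\<exists>z. m^2 = 4 * z + 1) \<and> odd m"
      using even_sq odd_sq by blast
    show ?thesis
    proof (cases "D mod 4 = 1")
      case True
      \<comment> \<open>Here
        \<open>x = (m + l * sqrt D) / 2 = (m - l) / 2 + l * omega\<close>.\<close>
      then have "even (m - l)" using l_odd l_even m_sq by presburger
      then obtain r where "m - l = 2 * r" by (rule evenE)
      then have "x = of_int r + of_int l * omega"
        using True m l ab by (simp add: omega_def field_simps)
      then show ?thesis by (rule that)
    next
      case False
      then have "even l" using l_odd m_sq D4 by presburger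
      then have "even m" "even l" using l_even by auto
      then obtain r u where "m = 2 * r" "l = 2 * u" by (auto elim!: evenE)
      then have "x = of_int r + of_int u * omega"
        using False m l ab by (simp add: omega_def)
      then show ?thesis by (rule that)
    qed
  qed
qed

section \<open>Conjugation, norms and determinants in integral coordinates\<close>

lemma OK_add: "x \<in> OK \<Longrightarrow> y \<in> OK \<Longrightarrow> x + y \<in> OK"
  and cj_add: "x \<in> OK \<Longrightarrow> y \<in> OK \<Longrightarrow> cj (x + y) = cj x + cj y"
proof -
  assume "x \<in> OK" "y \<in> OK"
  then obtain p q a b where xy: "x = of_int p + of_int q * omega" "y = of_int a + of_int b * omega"
    by (metis OK_coords)
  then have "x + y = of_int (p + a) + of_int (q + b) * omega"
    by (simp add: algebra_simps)
  then show "x + y \<in> OK" "cj (x + y) = cj x + cj y"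
    using coords_in_OK cj_coords by (simp_all only: xy) (simp add: algebra_simps)
qed

lemma OK_mult_int: "x \<in> OK \<Longrightarrow> of_int k * x \<in> OK"
  and cj_mult_int: "x \<in> OK \<Longrightarrow> cj (of_int k * x) = of_int k * cj x"
proof -
  assume "x \<in> OK"
  then obtain p q where x: "x = of_int p + of_int q * omega"
    by (metis OK_coords)
  then have "of_int k * x = of_int (k * p) + of_int (k * q) * omega"
    by (simp add: algebra_simps)
  then show "of_int k * x \<in> OK" "cj (of_int k * x) = of_int k * cj x"
    using coords_in_OK cj_coords by (simp_all only: x) (simp add: algebra_simps)
qed

lemma OK_diff: "x \<in> OK \<Longrightarrow> y \<in> OK \<Longrightarrow> x - y \<in> OK"
  and cj_diff: "x \<in> OK \<Longrightarrow> y \<in> OK \<Longrightarrow> cj (x - y) = cj x - cj y"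
  using OK_add[of x "of_int (-1) * y"] cj_add[of x "of_int (-1) * y"]
    OK_mult_int[of y "-1"] cj_mult_int[of y "-1"] by simp_all

lemma cj_OK: "x \<in> OK \<Longrightarrow> cj x \<in> OK"
  and cj_cj: "x \<in> OK \<Longrightarrow> cj (cj x) = x"
proof -
  assume "x \<in> OK"
  then obtain p q where x: "x = of_int p + of_int q * omega"
    by (metis OK_coords)
  obtain tr nm where "omega + omega' = of_int tr"
    by (rule omega_trace_norm)
  then have omega': "omega' = of_int tr - omega" by simp
  have "cj x = of_int (p + q * tr) + of_int (- q) * omega"
    unfolding x cj_coords omega' by (simp add: algebra_simps)
  then show "cj x \<in> OK" "cj (cj x) = x"
    using coords_in_OK cj_coords by (simp_all only: x)
qed

lemma norm_int:
  assumes "x \<in> OK"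
  obtains n :: int where "x * cj x = of_int n"
proof -
  obtain p q where x: "x = of_int p + of_int q * omega"
    using assms by (metis OK_coords)
  obtain tr nm where tn: "omega + omega' = of_int tr" "omega * omega' = of_int nm"
    by (rule omega_trace_norm)
  have "x * cj x = of_int p ^ 2 + of_int (p * q) * (omega + omega') + of_int q ^ 2 * (omega * omega')"
    unfolding x cj_coords by (simp add: power2_eq_square algebra_simps)
  then have "x * cj x = of_int (p^2 + p * q * tr + q^2 * nm)"
    unfolding tn by simp
  then show ?thesis by (rule that)
qed

lemma cj_0 [simp]: "cj 0 = 0"
  using cj_coords[of 0 0] by simp

lemma abs_norm_ge_1:
  assumes "x \<in> OK" "x \<noteq> 0"
  shows "\<bar>x * cj x\<bar> \<ge> 1"
proof -
  obtain n where n: "x * cj x = of_int n"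
    using assms(1) by (rule norm_int)
  have "cj x \<noteq> 0"
    using assms cj_cj cj_0 by metis
  then have "n \<noteq> 0" using n assms(2) by auto
  then show ?thesis unfolding n by linarith
qed

text \<open>The integer is the determinant of the coordinates up to sign; the base change
  contributes \<open>omega - omega' = s\<close>.\<close>

lemma det_int:
  assumes "x \<in> OK" "y \<in> OK"
  obtains k :: int where "x * cj y - cj x * y = of_int k * s"
proof -
  obtain p q a b where xy: "x = of_int p + of_int q * omega" "y = of_int a + of_int b * omega"
    using assms by (metis OK_coords)
  have "x * cj y - cj x * y = of_int (q * a - p * b) * s"
    unfolding xy cj_coords omega_diff[symmetric] by (simp add: algebra_simps)
  then show ?thesis by (rule that)
qed

text \<open>Cramer's rule: dividing the two lattice determinants by the minimal one,
  \<open>s\<close>, leaves integers.\<close>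

lemma unit_det_basis:
  assumes "x \<in> OK" "\<beta> \<in> OK" "\<gamma> \<in> OK" and det: "\<gamma> * cj \<beta> - cj \<gamma> * \<beta> = s"
  obtains e f :: int where "x = of_int e * \<beta> + of_int f * \<gamma>"
    "x * cj \<beta> - cj x * \<beta> = of_int f * s" "\<gamma> * cj x - cj \<gamma> * x = of_int e * s"
proof -
  obtain f where f: "x * cj \<beta> - cj x * \<beta> = of_int f * s"
    using assms(1,2) by (rule det_int)
  obtain e where e: "\<gamma> * cj x - cj \<gamma> * x = of_int e * s"
    using assms(3,1) by (rule det_int)
  have "(of_int e * \<beta> + of_int f * \<gamma>) * s = (\<gamma> * cj x - cj \<gamma> * x) * \<beta> + (x * cj \<beta> - cj x * \<beta>) * \<gamma>"
    unfolding e f by (simp add: algebra_simps)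
  also have "\<dots> = x * (\<gamma> * cj \<beta> - cj \<gamma> * \<beta>)" by (simp add: algebra_simps)
  finally have "x = of_int e * \<beta> + of_int f * \<gamma>"
    unfolding det using s_pos by simp
  then show ?thesis using that e f by blast
qed

subsection \<open>Neighbouring indecomposables\<close>

lemma OKpos_iff: "x \<in> OKpos \<longleftrightarrow> x \<in> OK \<and> x > 0 \<and> cj x > 0"
  by (simp add: tot_pos_integers_def)

lemma Indec_OKpos: "x \<in> Indec \<Longrightarrow> x \<in> OKpos"
  by (simp add: indecomposables_def)

lemma Indec_OK: "x \<in> Indec \<Longrightarrow> x \<in> OK"
  and Indec_pos: "x \<in> Indec \<Longrightarrow> x > 0"
  and Indec_cj_pos: "x \<in> Indec \<Longrightarrow> cj x > 0"
  by (simp_all add: indecomposables_def OKpos_iff)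

text \<open>An element smaller in both coordinates could be split off, with totally positive
  remainder \<open>\<beta> - y\<close>.\<close>

lemma Indec_not_above:
  assumes "\<beta> \<in> Indec" "y \<in> OKpos" "y < \<beta>"
  shows "cj y \<ge> cj \<beta>"
proof (rule ccontr)
  assume "\<not> cj \<beta> \<le> cj y"
  then have "\<beta> - y \<in> OKpos"
    using assms by (simp add: OKpos_iff Indec_OK OK_diff cj_diff)
  moreover have "\<beta> = y + (\<beta> - y)" by simp
  ultimately show False
    using assms(1,2) unfolding indecomposables_def by blast
qed

text \<open>Conjugation reflects the lattice in the diagonal; this turns successors into
  predecessors later on.\<close>

lemma cj_Indec:
  assumes "x \<in> Indec"
  shows "cj x \<in> Indec"
proof -
  have OKpos_cj: "y \<in> OKpos \<Longrightarrow> cj y \<in> OKpos" for y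
    by (simp add: OKpos_iff cj_OK cj_cj)
  have "False" if "y \<in> OKpos" "z \<in> OKpos" "cj x = y + z" for y z
  proof -
    have "x = cj y + cj z"
      using that assms by (metis OKpos_iff Indec_OK cj_add cj_cj)
    then show False
      using assms OKpos_cj that by (auto simp: indecomposables_def)
  qed
  then show ?thesis
    using OKpos_cj assms by (auto simp: indecomposables_def)
qed

text \<open>A common factor \<open>g \<ge> 2\<close> would put \<open>\<beta> / g\<close> below
  \<open>\<beta>\<close> in both coordinates. Primitivity supplies the Bezout relation used for the
  successor.\<close>

lemma Indec_primitive:
  assumes "of_int p + of_int q * omega \<in> Indec"
  shows "gcd p q = 1"
proof (rule ccontr)
  define \<beta> where "\<beta> = of_int p + of_int q * omega"
  define g where "g = gcd p q"
  assume "gcd p q \<noteq> 1"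
  moreover have "g \<noteq> 0"
    using Indec_pos[OF assms] by (auto simp: g_def)
  moreover have "g \<ge> 0" by (simp add: g_def)
  ultimately have g: "g \<ge> 2" unfolding g_def by linarith
  obtain p1 q1 where pq: "p = g * p1" "q = g * q1"
    unfolding g_def by (meson dvdE gcd_dvd1 gcd_dvd2)
  define y where "y = of_int p1 + of_int q1 * omega"
  have y: "y \<in> OK" unfolding y_def by (rule coords_in_OK)
  have \<beta>: "\<beta> = of_int g * y"
    unfolding \<beta>_def y_def pq by (simp add: algebra_simps)
  have "\<beta> > 0" "cj \<beta> > 0"
    using Indec_pos Indec_cj_pos assms unfolding \<beta>_def by auto
  then have ypos: "y > 0" "cj y > 0"
    unfolding \<beta> cj_mult_int[OF y] using g by (simp_all add: zero_less_mult_iff)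
  then have "y \<in> OKpos" using y by (simp add: OKpos_iff)
  moreover have "y < \<beta>" "cj y < cj \<beta>"
    unfolding \<beta> cj_mult_int[OF y] using g ypos by simp_all
  ultimately show False
    using Indec_not_above[of \<beta> y] assms by (simp add: \<beta>_def)
qed

text \<open>A lattice vector of determinant \<open>s\<close> against \<open>\<beta>\<close> is
  translated by multiples of \<open>\<beta>\<close> into the strip below \<open>cj \<beta>\<close>.
  It cannot split: both summands would have determinant at least \<open>s\<close> against
  \<open>\<beta>\<close>.\<close>

lemma Indec_succ_exists:
  assumes \<beta>: "\<beta> \<in> Indec"
  obtains \<gamma> where "\<gamma> \<in> Indec" "\<gamma> * cj \<beta> - cj \<gamma> * \<beta> = s" "\<beta> < \<gamma>" "cj \<gamma> < cj \<beta>"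
proof -
  note pos = Indec_pos[OF \<beta>] Indec_cj_pos[OF \<beta>]
  obtain p q where pq: "\<beta> = of_int p + of_int q * omega"
    using \<beta> by (metis OK_coords Indec_OK)
  obtain u v where uv: "u * p + v * q = 1"
    using bezout_int[of p q] Indec_primitive \<beta> unfolding pq by metis
  \<comment> \<open>The Bezout coefficients are placed so that the coordinate determinant against
    \<open>\<beta>\<close> is \<open>u * p + v * q = 1\<close>.\<close>
  define \<gamma>0 where "\<gamma>0 = of_int (- v) + of_int u * omega"
  have \<gamma>0: "\<gamma>0 \<in> OK" unfolding \<gamma>0_def by (rule coords_in_OK)
  have "\<gamma>0 * cj \<beta> - cj \<gamma>0 * \<beta> = of_int (u * p + v * q) * s"
    unfolding \<gamma>0_def pq cj_coords omega_diff[symmetric] by (simp add: algebra_simps)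
  then have det0: "\<gamma>0 * cj \<beta> - cj \<gamma>0 * \<beta> = s"
    by (simp add: uv)
  \<comment> \<open>Subtracting multiples of \<open>\<beta>\<close> keeps the determinant; the floor
    brings the conjugate into the interval from 0 to \<open>cj \<beta>\<close>.\<close>
  define k where "k = \<lfloor>cj \<gamma>0 / cj \<beta>\<rfloor>"
  define \<gamma> where "\<gamma> = \<gamma>0 - of_int k * \<beta>"
  have \<gamma>: "\<gamma> \<in> OK" and cj\<gamma>: "cj \<gamma> = cj \<gamma>0 - of_int k * cj \<beta>"
    by (simp_all add: \<gamma>_def \<gamma>0 \<beta> Indec_OK OK_mult_int OK_diff cj_diff cj_mult_int)
  have det: "\<gamma> * cj \<beta> - cj \<gamma> * \<beta> = s"
    unfolding cj\<gamma> using det0 by (simp add: \<gamma>_def left_diff_distrib)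
  have "of_int k \<le> cj \<gamma>0 / cj \<beta>" "cj \<gamma>0 / cj \<beta> < of_int k + 1"
    by (simp_all add: k_def)
  then have "cj \<gamma> \<ge> 0" and cj_less: "cj \<gamma> < cj \<beta>"
    using pos by (simp_all add: cj\<gamma> field_simps)
  \<comment> \<open>A zero conjugate would make \<open>\<gamma>\<close> zero, and the determinant
    with it.\<close>
  moreover have "cj \<gamma> \<noteq> 0"
    using det s_pos cj_cj[OF \<gamma>] by auto
  ultimately have cj_pos: "cj \<gamma> > 0" by simp
  have "\<gamma> * cj \<beta> = s + cj \<gamma> * \<beta>" using det by simp
  also have "\<dots> > 0" using s_pos cj_pos pos by (simp add: add_pos_pos)
  finally have "\<gamma> > 0" using pos by (simp add: zero_less_mult_iff)
  then have \<gamma>pos: "\<gamma> \<in> OKpos" using \<gamma> cj_pos by (simp add: OKpos_iff)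
  \<comment> \<open>Otherwise \<open>y\<close> would lie below \<open>\<beta>\<close> in both
    coordinates.\<close>
  have right_of: "y * cj \<beta> - cj y * \<beta> > 0" if y: "y \<in> OKpos" "cj y < cj \<gamma>" for y
  proof (rule ccontr)
    assume "\<not> y * cj \<beta> - cj y * \<beta> > 0"
    then have "y * cj \<beta> \<le> cj y * \<beta>" by simp
    also have "\<dots> < cj \<beta> * \<beta>" using y cj_less pos by simp
    finally have "y < \<beta>" using pos by simp
    then show False
      using Indec_not_above[OF \<beta> y(1)] y(2) cj_less by simp
  qed
  have "False" if yz: "y \<in> OKpos" "z \<in> OKpos" "\<gamma> = y + z" for y z
  proof -
    have yzOK: "y \<in> OK" "z \<in> OK" and yz_pos: "cj y > 0" "cj z > 0"
      using yz by (simp_all add: OKpos_iff)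
    have cj_yz: "cj \<gamma> = cj y + cj z" using yzOK yz(3) cj_add by simp
    obtain k l where kl: "y * cj \<beta> - cj y * \<beta> = of_int k * s" "z * cj \<beta> - cj z * \<beta> = of_int l * s"
      using det_int yzOK Indec_OK[OF \<beta>] by metis
    have "of_int k * s > 0" "of_int l * s > 0"
      using right_of[OF yz(1)] right_of[OF yz(2)] cj_yz yz_pos unfolding kl by simp_all
    then have "k \<ge> 1" "l \<ge> 1" using s_pos by (simp_all add: zero_less_mult_iff)
    have "of_int (k + l) * s = \<gamma> * cj \<beta> - cj \<gamma> * \<beta>"
      using kl by (subst cj_yz, subst yz(3)) (simp add: algebra_simps)
    then have "of_int (k + l) * s = 1 * s" using det by simp
    then have "k + l = 1" using s_pos by (metis mult_cancel_right less_irrefl of_int_eq_1_iff)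
    then show False using \<open>k \<ge> 1\<close> \<open>l \<ge> 1\<close> by simp
  qed
  then have "\<gamma> \<in> Indec" using \<gamma>pos by (auto simp: indecomposables_def)
  moreover have "\<gamma> \<noteq> \<beta>" "\<not> \<gamma> < \<beta>"
    using Indec_not_above[OF \<beta> \<gamma>pos] cj_less by auto
  then have "\<beta> < \<gamma>" by simp
  ultimately show ?thesis using that det cj_less by blast
qed

text \<open>The conjugate of the successor of \<open>cj \<beta>\<close> serves as predecessor of
  \<open>\<beta>\<close>.\<close>

lemma Indec_pred_exists:
  assumes \<beta>: "\<beta> \<in> Indec"
  obtains \<delta> where "\<delta> \<in> Indec" "\<beta> * cj \<delta> - cj \<beta> * \<delta> = s" "\<delta> < \<beta>" "cj \<beta> < cj \<delta>"
proof -
  obtain \<gamma> where "\<gamma> \<in> Indec" "\<gamma> * cj (cj \<beta>) - cj \<gamma> * cj \<beta> = s" "cj \<beta> < \<gamma>" "cj \<gamma> < cj (cj \<beta>)"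
    using Indec_succ_exists[OF cj_Indec[OF \<beta>]] by metis
  then show ?thesis
    using that[of "cj \<gamma>"] \<beta> by (simp add: cj_Indec cj_cj Indec_OK mult.commute)
qed

text \<open>The difference to a neighbour has mixed signature and norm at most \<open>-1\<close>, so AM-GM applied to
  the determinant of the two neighbours bounds the norm.\<close>

lemma Indec_norm_le:
  assumes \<beta>: "\<beta> \<in> Indec"
  shows "4 * (\<beta> * cj \<beta>) \<le> s^2"
proof -
  obtain \<gamma> where \<gamma>: "\<gamma> \<in> Indec" "\<gamma> * cj \<beta> - cj \<gamma> * \<beta> = s" "\<beta> < \<gamma>" "cj \<gamma> < cj \<beta>"
    using Indec_succ_exists[OF \<beta>] by metis
  define t u where "t = \<gamma> - \<beta>" and "u = cj \<beta> - cj \<gamma>"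
  have tu: "t > 0" "u > 0" using \<gamma> by (simp_all add: t_def u_def)
  have "\<bar>(\<gamma> - \<beta>) * cj (\<gamma> - \<beta>)\<bar> \<ge> 1"
    using abs_norm_ge_1[of "\<gamma> - \<beta>"] \<gamma> \<beta> by (simp add: OK_diff Indec_OK)
  then have "\<bar>- (t * u)\<bar> \<ge> 1"
    using cj_diff \<gamma>(1) \<beta> by (simp add: t_def u_def Indec_OK algebra_simps)
  then have tu1: "t * u \<ge> 1" using tu by simp
  have s: "s = t * cj \<beta> + u * \<beta>"
    unfolding \<gamma>(2)[symmetric] t_def u_def by (simp add: algebra_simps)
  have "s^2 = 4 * (t * u) * (\<beta> * cj \<beta>) + (t * cj \<beta> - u * \<beta>)^2"
    unfolding s by (simp add: power2_eq_square algebra_simps)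
  then have "4 * ((t * u) * (\<beta> * cj \<beta>)) \<le> s^2" by simp
  moreover have "1 * (\<beta> * cj \<beta>) \<le> (t * u) * (\<beta> * cj \<beta>)"
    using tu1 Indec_pos[OF \<beta>] Indec_cj_pos[OF \<beta>] by (intro mult_right_mono) simp_all
  ultimately show ?thesis by linarith
qed

text \<open>In the basis \<open>\<beta>, \<gamma>\<close> the determinant fixes the
  \<open>\<gamma>\<close>-coefficient of \<open>\<delta>\<close> as -1. The factor \<open>v\<close>
  is not 1, as \<open>\<beta>\<close> does not split; multiplying the relation by
  \<open>cj \<beta>\<close> bounds it.\<close>

lemma Indec_neighbour_sum:
  assumes "\<beta> \<in> Indec" "\<gamma> \<in> Indec" "\<delta> \<in> Indec"
    and \<gamma>: "\<gamma> * cj \<beta> - cj \<gamma> * \<beta> = s" "cj \<gamma> < cj \<beta>"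
    and \<delta>: "\<beta> * cj \<delta> - cj \<beta> * \<delta> = s" "\<delta> < \<beta>"
  obtains v :: nat where "v \<ge> 2" "\<delta> + \<gamma> = of_nat v * \<beta>" "(real v - 2) * (\<beta> * cj \<beta>) < s"
proof -
  note pos = Indec_pos[OF assms(1)] Indec_cj_pos[OF assms(1)]
    Indec_pos[OF assms(2)] Indec_pos[OF assms(3)]
  obtain e f where ef: "\<delta> = of_int e * \<beta> + of_int f * \<gamma>" "\<delta> * cj \<beta> - cj \<delta> * \<beta> = of_int f * s"
    using unit_det_basis[OF _ _ _ \<gamma>(1), of \<delta>] assms(1-3) Indec_OK by metis
  have "(of_int f + 1) * s = 0" using ef(2) \<delta>(1) by (simp add: algebra_simps)
  then have "real_of_int f + 1 = 0" using s_pos by simp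
  then have "f = -1" by linarith
  then have sum: "\<delta> + \<gamma> = of_int e * \<beta>" using ef(1) by simp
  moreover have "\<delta> + \<gamma> > 0" using pos by simp
  ultimately have "of_int e * \<beta> > 0" by simp
  then have "e > 0" using pos by (simp add: zero_less_mult_iff)
  moreover have "e \<noteq> 1"
  proof
    assume "e = 1"
    then have "\<beta> = \<delta> + \<gamma>" using sum by simp
    moreover have "\<delta> \<in> OKpos" "\<gamma> \<in> OKpos" using assms(2,3) Indec_OKpos by auto
    ultimately show False using assms(1) unfolding indecomposables_def by blast
  qed
  ultimately have e: "nat e \<ge> 2" "of_nat (nat e) = (of_int e :: real)" by simp_all
  \<comment> \<open>Each of \<open>\<delta> * cj \<beta>\<close> and
    \<open>cj \<gamma> * \<beta>\<close> is less than the norm of \<open>\<beta>\<close>, which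
    accounts for the 2 in \<open>v - 2\<close>.\<close>
  have "of_int e * \<beta> * cj \<beta> = \<delta> * cj \<beta> + (s + cj \<gamma> * \<beta>)"
    unfolding sum[symmetric] using \<gamma>(1) by (simp add: algebra_simps)
  moreover have "\<delta> * cj \<beta> < \<beta> * cj \<beta>" "cj \<gamma> * \<beta> < cj \<beta> * \<beta>"
    using \<delta>(2) \<gamma>(2) pos by simp_all
  ultimately have "(of_int e - 2) * (\<beta> * cj \<beta>) < s"
    by (simp add: algebra_simps)
  then show ?thesis using that[of "nat e"] e sum by simp
qed

section \<open>Bounded lattice boxes and the cone decomposition\<close>

text \<open>\<open>z - cj z = q * s\<close> bounds \<open>q\<close>, and then
  \<open>p = z - q * omega\<close> is bounded too. This provides the minimum in
  \<open>cone_decomposition\<close>.\<close>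

lemma finite_OK_box: "finite {z \<in> OK. \<bar>z\<bar> \<le> M \<and> \<bar>cj z\<bar> \<le> M}"
proof (rule finite_subset)
  define B where "B = 2 * M / s"
  define A where "A = M + B * \<bar>omega\<bar>"
  show "finite ((\<lambda>(p, q). of_int p + of_int q * omega) `
    ({- \<lfloor>A\<rfloor>..\<lfloor>A\<rfloor>} \<times> {- \<lfloor>B\<rfloor>..\<lfloor>B\<rfloor>}))"
    by (intro finite_imageI finite_cartesian_product finite_atLeastAtMost_int)
  show "{z \<in> OK. \<bar>z\<bar> \<le> M \<and> \<bar>cj z\<bar> \<le> M} \<subseteq> (\<lambda>(p, q). of_int p + of_int q * omega) `
    ({- \<lfloor>A\<rfloor>..\<lfloor>A\<rfloor>} \<times> {- \<lfloor>B\<rfloor>..\<lfloor>B\<rfloor>})"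
  proof
    fix z assume z: "z \<in> {z \<in> OK. \<bar>z\<bar> \<le> M \<and> \<bar>cj z\<bar> \<le> M}"
    then obtain p q where pq: "z = of_int p + of_int q * omega"
      using OK_coords by blast
    have "of_int q * s = z - cj z"
      unfolding pq cj_coords omega_diff[symmetric] by (simp add: algebra_simps)
    then have "\<bar>of_int q\<bar> * s = \<bar>z - cj z\<bar>"
      using s_pos by (metis abs_mult abs_of_pos)
    then have "\<bar>of_int q\<bar> * s \<le> 2 * M" using z by auto
    then have q: "\<bar>real_of_int q\<bar> \<le> B" using s_pos by (simp add: B_def field_simps)
    have "\<bar>real_of_int p\<bar> \<le> \<bar>z\<bar> + \<bar>of_int q\<bar> * \<bar>omega\<bar>"
      unfolding pq abs_mult[symmetric] by linarith
    also have "\<dots> \<le> A"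
      unfolding A_def using z q by (intro add_mono mult_right_mono) simp_all
    finally have "p \<in> {- \<lfloor>A\<rfloor>..\<lfloor>A\<rfloor>}" "q \<in> {- \<lfloor>B\<rfloor>..\<lfloor>B\<rfloor>}"
      using q by (simp_all add: le_floor_iff minus_le_iff abs_le_iff)
    then show "z \<in> (\<lambda>(p, q). of_int p + of_int q * omega) `
      ({- \<lfloor>A\<rfloor>..\<lfloor>A\<rfloor>} \<times> {- \<lfloor>B\<rfloor>..\<lfloor>B\<rfloor>})"
      using pq by auto
  qed
qed

text \<open>Take \<open>\<beta>\<close> to be the element of smallest conjugate among those on or above the ray through
  \<open>\<alpha>\<close>; its successor then lies strictly below that ray.\<close>

lemma cone_decomposition:
  assumes \<alpha>: "\<alpha> \<in> OKpos"
  obtains \<beta> \<gamma> and e f :: nat where "\<beta> \<in> Indec" "\<gamma> \<in> Indec" "\<gamma> * cj \<beta> - cj \<gamma> * \<beta> = s"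
    "\<beta> < \<gamma>" "cj \<gamma> < cj \<beta>" "\<alpha> = of_nat e * \<beta> + of_nat f * \<gamma>"
proof -
  have pos: "\<alpha> > 0" "cj \<alpha> > 0" and \<alpha>OK: "\<alpha> \<in> OK" using \<alpha> by (auto simp: OKpos_iff)
  \<comment> \<open>The second inequality places \<open>z\<close> on or above the ray through
    \<open>\<alpha>\<close>; with the first it gives \<open>z \<le> \<alpha>\<close>, so
    \<open>S\<close> lies in a box.\<close>
  define S where "S = {z \<in> OKpos. cj z \<le> cj \<alpha> \<and> z * cj \<alpha> \<le> cj z * \<alpha>}"
  have "S \<subseteq> {z \<in> OK. \<bar>z\<bar> \<le> max \<alpha> (cj \<alpha>) \<and> \<bar>cj z\<bar> \<le> max \<alpha> (cj \<alpha>)}"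
  proof
    fix z assume z: "z \<in> S"
    then have "z * cj \<alpha> \<le> cj z * \<alpha>" "cj z * \<alpha> \<le> cj \<alpha> * \<alpha>"
      using pos by (auto simp: S_def)
    then have "z * cj \<alpha> \<le> \<alpha> * cj \<alpha>" by (simp add: mult.commute)
    then have "z \<le> \<alpha>" using pos by simp
    then show "z \<in> {z \<in> OK. \<bar>z\<bar> \<le> max \<alpha> (cj \<alpha>) \<and> \<bar>cj z\<bar> \<le> max \<alpha> (cj \<alpha>)}"
      using z by (auto simp: S_def OKpos_iff)
  qed
  then have "finite S" using finite_OK_box finite_subset by blast
  moreover have "\<alpha> \<in> S" using \<alpha> by (simp add: S_def mult.commute)
  ultimately obtain \<beta> where \<beta>S: "\<beta> \<in> S" and min: "\<And>z. z \<in> S \<Longrightarrow> cj \<beta> \<le> cj z"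
    using ex_is_arg_min_if_finite[of S cj] by (auto simp: is_arg_min_linorder)
  have \<beta>pos: "\<beta> \<in> OKpos" using \<beta>S by (simp add: S_def)
  have below: "z * cj \<alpha> > cj z * \<alpha>" if "z \<in> OKpos" "cj z < cj \<beta>" for z
    using min[of z] that \<beta>S by (auto simp: S_def not_le[symmetric])
  \<comment> \<open>Both summands would have a smaller conjugate, hence lie strictly below the ray,
    and so would their sum \<open>\<beta>\<close>.\<close>
  have "False" if yz: "y \<in> OKpos" "z \<in> OKpos" "\<beta> = y + z" for y z
  proof -
    have cj: "cj \<beta> = cj y + cj z" "cj y > 0" "cj z > 0"
      using yz by (simp_all add: OKpos_iff cj_add)
    then have "y * cj \<alpha> + z * cj \<alpha> > cj y * \<alpha> + cj z * \<alpha>"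
      using below[OF yz(1)] below[OF yz(2)] by simp
    then show False using \<beta>S cj yz(3) by (simp add: S_def algebra_simps)
  qed
  then have \<beta>: "\<beta> \<in> Indec" using \<beta>pos by (auto simp: indecomposables_def)
  obtain \<gamma> where \<gamma>: "\<gamma> \<in> Indec" "\<gamma> * cj \<beta> - cj \<gamma> * \<beta> = s" "\<beta> < \<gamma>" "cj \<gamma> < cj \<beta>"
    using Indec_succ_exists[OF \<beta>] by metis
  obtain e f where ef: "\<alpha> = of_int e * \<beta> + of_int f * \<gamma>"
    "\<alpha> * cj \<beta> - cj \<alpha> * \<beta> = of_int f * s" "\<gamma> * cj \<alpha> - cj \<gamma> * \<alpha> = of_int e * s"
    using unit_det_basis[OF \<alpha>OK Indec_OK[OF \<beta>] Indec_OK[OF \<gamma>(1)] \<gamma>(2)] by metis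
  \<comment> \<open>The positions of \<open>\<beta>\<close> and \<open>\<gamma>\<close> relative to
    the ray are the signs of the Cramer determinants.\<close>
  have "of_int f * s \<ge> 0"
    using \<beta>S unfolding ef(2)[symmetric] by (simp add: S_def mult.commute)
  then have "f \<ge> 0" using s_pos by (simp add: zero_le_mult_iff)
  have "of_int e * s > 0"
    using below[OF Indec_OKpos[OF \<gamma>(1)] \<gamma>(4)] unfolding ef(3)[symmetric] by simp
  then have "e \<ge> 0" using s_pos by (simp add: zero_less_mult_iff)
  then have "\<alpha> = of_nat (nat e) * \<beta> + of_nat (nat f) * \<gamma>"
    using ef(1) \<open>f \<ge> 0\<close> by simp
  then show ?thesis using that \<beta> \<gamma> by blast
qed

subsection \<open>Exchanging partitions\<close>

text \<open>Exchanged partitions are told apart by their numbers of \<open>\<delta>\<close> and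
  \<open>\<epsilon>\<close>, which the strict order separates from each other and from
  \<open>\<beta>\<close>, \<open>\<gamma>\<close>.\<close>

lemma exponents_bound:
  assumes part: "indecomposable_partitions D \<alpha> = 2" and "\<alpha> > 0"
    and \<alpha>: "\<alpha> = of_nat e * \<beta> + of_nat f * \<gamma>"
    and ind: "\<beta> \<in> Indec" "\<gamma> \<in> Indec" "\<delta> \<in> Indec" "\<epsilon> \<in> Indec"
    and ord: "\<delta> < \<beta>" "\<beta> < \<gamma>" "\<gamma> < \<epsilon>"
    and v: "\<delta> + \<gamma> = of_nat v * \<beta>" and w: "\<beta> + \<epsilon> = of_nat w * \<gamma>"
  shows "e < 2 * v \<and> f < w \<or> e < v \<and> f < 2 * w"
proof -
  define T where "T = {M. M \<noteq> {#} \<and> set_mset M \<subseteq> Indec \<and> sum_mset M = \<alpha>}"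
  have T: "card T = 2" using part by (simp add: T_def indecomposable_partitions_def)
  define M where "M a b c d = replicate_mset a \<delta> + replicate_mset b \<beta> + replicate_mset c \<gamma>
    + replicate_mset d \<epsilon>" for a b c d
  have M_T: "M a b c d \<in> T"
    if "of_nat a * \<delta> + of_nat b * \<beta> + of_nat c * \<gamma> + of_nat d * \<epsilon> = \<alpha>" for a b c d
  proof -
    have "sum_mset (M a b c d) = \<alpha>" using that by (simp add: M_def)
    moreover from this have "M a b c d \<noteq> {#}" using \<open>\<alpha> > 0\<close> by auto
    moreover have "set_mset (M a b c d) \<subseteq> Indec" using ind by (auto simp: M_def)
    ultimately show ?thesis by (simp add: T_def)
  qed
  have "(count (M a b c d) \<delta>, count (M a b c d) \<epsilon>) = (a, d)" for a b c d
    using ord by (simp add: M_def)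
  then have M_neq: "M a b c d \<noteq> M a' b' c' d'" if "(a, d) \<noteq> (a', d')" for a b c d a' b' c' d'
    using that by metis
  have no3: False if "X \<in> T" "Y \<in> T" "Z \<in> T" "X \<noteq> Y" "X \<noteq> Z" "Y \<noteq> Z" for X Y Z
  proof -
    \<comment> \<open>\<open>card T = 2\<close> also makes \<open>T\<close> finite, as infinite sets
      have cardinality 0.\<close>
    have "card {X, Y, Z} \<le> card T"
      using that T by (intro card_mono) (auto intro: card_ge_0_finite)
    then show False using that T by simp
  qed
  have M0: "M 0 e f 0 \<in> T" using \<alpha> by (intro M_T) simp
  \<comment> \<open>The exchange at \<open>\<beta>\<close> made \<open>k\<close> times; the guard
    keeps the natural subtraction exact.\<close>
  have Mv: "M k (e - k * v) (f + k) 0 \<in> T" if "k * v \<le> e" for k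
  proof (rule M_T)
    have "of_nat e = of_nat (e - k * v) + real k * real v" using that by (simp add: of_nat_diff)
    then have "\<alpha> = of_nat (e - k * v) * \<beta> + of_nat f * \<gamma> + real k * (real v * \<beta>)"
      using \<alpha> by (simp add: algebra_simps)
    then show "of_nat k * \<delta> + of_nat (e - k * v) * \<beta> + of_nat (f + k) * \<gamma> + of_nat 0 * \<epsilon> = \<alpha>"
      unfolding v[symmetric] by (simp add: algebra_simps)
  qed
  have Mw: "M 0 (e + k) (f - k * w) k \<in> T" if "k * w \<le> f" for k
  proof (rule M_T)
    have "of_nat f = of_nat (f - k * w) + real k * real w" using that by (simp add: of_nat_diff)
    then have "\<alpha> = of_nat e * \<beta> + of_nat (f - k * w) * \<gamma> + real k * (real w * \<gamma>)"
      using \<alpha> by (simp add: algebra_simps)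
    then show "of_nat 0 * \<delta> + of_nat (e + k) * \<beta> + of_nat (f - k * w) * \<gamma> + of_nat k * \<epsilon> = \<alpha>"
      unfolding w[symmetric] by (simp add: algebra_simps)
  qed
  have "e < 2 * v"
  proof (rule ccontr)
    assume "\<not> e < 2 * v"
    then show False
      using no3[OF M0 Mv[of 1] Mv[of 2]] M_neq by simp
  qed
  moreover have "f < 2 * w"
  proof (rule ccontr)
    assume "\<not> f < 2 * w"
    then show False
      using no3[OF M0 Mw[of 1] Mw[of 2]] M_neq by simp
  qed
  moreover have "e < v \<or> f < w"
  proof (rule ccontr)
    assume "\<not> (e < v \<or> f < w)"
    then show False
      using no3[OF M0 Mv[of 1] Mw[of 1]] M_neq by simp
  qed
  ultimately show ?thesis by auto
qed

end

section \<open>Numerical estimate and the norm bound\<close>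

text \<open>In the application \<open>v = a + 2\<close> and \<open>w = b + 2\<close> are the coefficients of the neighbour relations,
  \<open>N\<close> and \<open>N'\<close> the norms of two adjacent indecomposables.\<close>

lemma norm_estimate:
  fixes e f a b N N' p s :: real
  assumes e: "0 \<le> e" "e \<le> 2 * a + 3" and f: "0 \<le> f" "f \<le> b + 1"
    and a: "0 \<le> a" "a * N \<le> s" and b: "0 \<le> b" "b * N' \<le> s"
    and N: "1 \<le> N" "4 * N \<le> s^2" and N': "1 \<le> N'" "4 * N' \<le> s^2"
    and p: "0 \<le> p" "p \<le> N" "p \<le> N'" and s: "2 \<le> s"
  shows "e^2 * N + f^2 * N' + e * f * (2 * p + s) < 5 * s * (s + 1) * (3 * s + 2)"
proof -
  have as: "a \<le> s" and bs: "b \<le> s"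
    using mult_left_mono[OF N(1) a(1)] mult_left_mono[OF N'(1) b(1)] a b by simp_all
  have "a * (a * N) \<le> s * s" "b * (b * N') \<le> s * s"
    using a b as bs N N' s by (intro mult_mono; simp)+
  then have aaN: "a^2 * N \<le> s^2" and bbN: "b^2 * N' \<le> s^2"
    by (simp_all add: power2_eq_square mult_ac)
  have "e^2 * N \<le> (2 * a + 3)^2 * N"
    using e N by (intro mult_right_mono power_mono) simp_all
  also have "\<dots> = 4 * (a^2 * N) + 12 * (a * N) + 9 * N"
    by (simp add: power2_eq_square algebra_simps)
  also have "\<dots> \<le> 4 * s^2 + 12 * s + 9 * s^2 / 4"
    using aaN a N by linarith
  finally have 1: "e^2 * N \<le> 4 * s^2 + 12 * s + 9 * s^2 / 4" .
  have "f^2 * N' \<le> (b + 1)^2 * N'"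
    using f N' by (intro mult_right_mono power_mono) simp_all
  also have "\<dots> = b^2 * N' + 2 * (b * N') + N'"
    by (simp add: power2_eq_square algebra_simps)
  also have "\<dots> \<le> s^2 + 2 * s + s^2 / 4"
    using bbN b N' by linarith
  finally have 2: "f^2 * N' \<le> s^2 + 2 * s + s^2 / 4" .
  \<comment> \<open>Comparing \<open>p\<close> with the norms rather than with \<open>s^2\<close>
    keeps \<open>a * p\<close> and \<open>b * p\<close> linear in \<open>s\<close>.\<close>
  have ap: "a * p \<le> s" using mult_left_mono[OF p(2) a(1)] a(2) by linarith
  have bp: "b * p \<le> s" using mult_left_mono[OF p(3) b(1)] b(2) by linarith
  have abp: "b * (a * p) \<le> s * s"
    using ap bs a b p s by (intro mult_mono) simp_all
  have ab: "a * b \<le> s * s"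
    using as bs a b s by (intro mult_mono) simp_all
  have ef: "e * f \<le> (2 * a + 3) * (b + 1)"
    using e f a b by (intro mult_mono) simp_all
  have "e * f * p \<le> (2 * a + 3) * (b + 1) * p"
    using ef p by (intro mult_right_mono) simp_all
  also have "\<dots> = 2 * (b * (a * p)) + 2 * (a * p) + 3 * (b * p) + 3 * p"
    by (simp add: algebra_simps)
  also have "\<dots> \<le> 2 * s^2 + 5 * s + 3 * s^2 / 4"
    using ap bp abp p N unfolding power2_eq_square by linarith
  finally have 3: "e * f * p \<le> 2 * s^2 + 5 * s + 3 * s^2 / 4" .
  have "(2 * a + 3) * (b + 1) = 2 * (a * b) + 2 * a + 3 * b + 3"
    by (simp add: algebra_simps)
  then have "e * f \<le> 2 * s^2 + 5 * s + 3"
    using ef ab as bs unfolding power2_eq_square by linarith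
  then have "e * f * s \<le> (2 * s^2 + 5 * s + 3) * s"
    using s by (intro mult_right_mono) simp_all
  then have 4: "e * f * s \<le> 2 * s^3 + 5 * s^2 + 3 * s"
    by (simp add: power3_eq_cube power2_eq_square algebra_simps)
  have rhs: "5 * s * (s + 1) * (3 * s + 2) = 15 * s^3 + 25 * s^2 + 10 * s"
    by (simp add: power3_eq_cube power2_eq_square algebra_simps)
  have s2: "s^2 \<ge> 2 * s" using s by (simp add: power2_eq_square)
  have s3: "s^3 \<ge> 2 * s^2" using s by (simp add: power3_eq_cube power2_eq_square mult_right_mono)
  have "e^2 * N + f^2 * N' + e * f * (2 * p + s) = e^2 * N + f^2 * N' + 2 * (e * f * p) + e * f * s"
    by (simp add: algebra_simps)
  \<comment> \<open>The four bounds add up to \<open>2 * s^3 + 18 * s^2 + 27 * s\<close>, which is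
    below the right-hand side once \<open>s \<ge> 2\<close>.\<close>
  then show ?thesis
    unfolding rhs using 1 2 3 4 s2 s3 s by linarith
qed

theorem theorem6p10:
  fixes D :: nat and \<alpha> :: real
  assumes "D \<ge> 2" and "squarefree D"
    and "\<alpha> \<in> tot_pos_integers D"
    and "indecomposable_partitions D \<alpha> = 2"
  shows "quad_norm D \<alpha> <
           5 * sqrt (real (quad_disc D)) * (sqrt (real (quad_disc D)) + 1)
             * (3 * sqrt (real (quad_disc D)) + 2)"
proof -
  interpret real_quadratic D using assms(1,2) by unfold_locales
  obtain \<beta> \<gamma> and e f :: nat where \<beta>: "\<beta> \<in> Indec" and \<gamma>: "\<gamma> \<in> Indec"
    and det: "\<gamma> * cj \<beta> - cj \<gamma> * \<beta> = s" and ord: "\<beta> < \<gamma>" "cj \<gamma> < cj \<beta>"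
    and \<alpha>: "\<alpha> = of_nat e * \<beta> + of_nat f * \<gamma>"
    using cone_decomposition[OF assms(3)] by metis
  obtain \<delta> where \<delta>: "\<delta> \<in> Indec" "\<beta> * cj \<delta> - cj \<beta> * \<delta> = s" "\<delta> < \<beta>" "cj \<beta> < cj \<delta>"
    using Indec_pred_exists[OF \<beta>] by metis
  obtain \<epsilon> where \<epsilon>: "\<epsilon> \<in> Indec" "\<epsilon> * cj \<gamma> - cj \<epsilon> * \<gamma> = s" "\<gamma> < \<epsilon>" "cj \<epsilon> < cj \<gamma>"
    using Indec_succ_exists[OF \<gamma>] by metis
  define N N' p where "N = \<beta> * cj \<beta>" and "N' = \<gamma> * cj \<gamma>" and "p = \<beta> * cj \<gamma>"
  obtain v :: nat where v: "v \<ge> 2" "\<delta> + \<gamma> = of_nat v * \<beta>" "(real v - 2) * N < s"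
    using Indec_neighbour_sum[OF \<beta> \<gamma> \<delta>(1) det ord(2) \<delta>(2,3)] unfolding N_def by metis
  obtain w :: nat where w: "w \<ge> 2" "\<beta> + \<epsilon> = of_nat w * \<gamma>" "(real w - 2) * N' < s"
    using Indec_neighbour_sum[OF \<gamma> \<epsilon>(1) \<beta> \<epsilon>(2,4) det ord(1)] unfolding N'_def by metis
  have pos: "\<beta> > 0" "cj \<beta> > 0" "\<gamma> > 0" "cj \<gamma> > 0"
    using \<beta> \<gamma> Indec_pos Indec_cj_pos by auto
  have "N > 0" "N' > 0" unfolding N_def N'_def using pos by simp_all
  then have N1: "N \<ge> 1" "N' \<ge> 1"
    using abs_norm_ge_1[OF Indec_OK[OF \<beta>]] abs_norm_ge_1[OF Indec_OK[OF \<gamma>]] pos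
    unfolding N_def N'_def by simp_all
  have N4: "4 * N \<le> s^2" "4 * N' \<le> s^2"
    using Indec_norm_le \<beta> \<gamma> by (simp_all add: N_def N'_def)
  have p: "0 \<le> p" "p \<le> N" "p \<le> N'"
    using pos ord by (simp_all add: p_def N_def N'_def)
  have "2^2 \<le> s^2" using N1(1) N4(1) by simp
  then have s2: "2 \<le> s" using s_pos by (meson less_imp_le power2_le_imp_le)
  have "cj \<alpha> = of_nat e * cj \<beta> + of_nat f * cj \<gamma>"
    unfolding \<alpha> using cj_add[of "of_int (int e) * \<beta>" "of_int (int f) * \<gamma>"] \<beta> \<gamma>
      cj_mult_int[of \<beta> "int e"] cj_mult_int[of \<gamma> "int f"]
      OK_mult_int[of \<beta> "int e"] OK_mult_int[of \<gamma> "int f"] by (simp add: Indec_OK)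
  \<comment> \<open>The cross term \<open>\<beta> * cj \<gamma> + \<gamma> * cj \<beta>\<close> is
    twice \<open>p\<close> plus the determinant.\<close>
  then have "\<alpha> * cj \<alpha> = (of_nat e)^2 * N + (of_nat f)^2 * N'
      + of_nat e * of_nat f * (2 * p + (\<gamma> * cj \<beta> - cj \<gamma> * \<beta>))"
    by (simp add: \<alpha> N_def N'_def p_def power2_eq_square algebra_simps)
  then have norm: "quad_norm D \<alpha> = (of_nat e)^2 * N + (of_nat f)^2 * N' + of_nat e * of_nat f * (2 * p + s)"
    by (simp add: quad_norm_def det)
  have "\<alpha> > 0" using assms(3) by (simp add: OKpos_iff)
  then have "e < 2 * v \<and> f < w \<or> e < v \<and> f < 2 * w"
    using exponents_bound[OF assms(4) _ \<alpha> \<beta> \<gamma> \<delta>(1) \<epsilon>(1) \<delta>(3) ord(1) \<epsilon>(3) v(2) w(2)] by simp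
  then have "quad_norm D \<alpha> < 5 * s * (s + 1) * (3 * s + 2)"
  proof
    \<comment> \<open>For integers this reads \<open>e \<le> 2 * (v - 2) + 3\<close> and
      \<open>f \<le> (w - 2) + 1\<close>, the form taken by \<open>norm_estimate\<close>.\<close>
    assume "e < 2 * v \<and> f < w"
    then show ?thesis
      unfolding norm
      using norm_estimate[of "of_nat e" "real v - 2" "of_nat f" "real w - 2" N s N' p] v w N1 N4 p s2
      by simp
  next
    \<comment> \<open>The estimate applies with the roles of \<open>\<beta>\<close> and
      \<open>\<gamma>\<close> exchanged.\<close>
    assume "e < v \<and> f < 2 * w"
    then show ?thesis
      unfolding norm
      using norm_estimate[of "of_nat f" "real w - 2" "of_nat e" "real v - 2" N' s N p] v w N1 N4 p s2
      by (simp add: mult_ac add_ac)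
  qed
  then show ?thesis by (simp only: s_def)
qed

end
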